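(* Let $\mathbf{R}_u,\mathbf{R}_v,\mathbf{R}_w,\mathbf{R}_0\in\mathbb{R}^3$ and $\mathbf{R}(u,v,w)=\mathbf{R}_u u+\mathbf{R}_v v+\mathbf{R}_w w+\mathbf{R}_0$. Define $$c_n^m(u,v,w)=R_n^m(\mathbf{R}(u,v,w)),\qquad d_n^m(u,v)=c_n^m(u,v,1-u-v),$$ $$b_n^m=\int_0^1\int_0^{1-v}d_n^m(u,v)\,du\,dv,\qquad e_n^m=\int_0^1 d_n^m(u,1-u)\,du,\qquad f_n^m=c_n^m(1,0,0).$$ Then for all integers $n\ge 1$ and $-n\le m\le n$, $$b_n^m=\frac{1}{n+2}\left(i(\xi_0+\xi_w)\,b_{n-1}^{m-1}+i(\eta_0+\eta_w)\,b_{n-1}^{m+1}-(z_0+z_w)\,b_{n-1}^m+e_n^m\right),$$ $$e_n^m=\frac{1}{n+1}\left[i(\xi_0+\xi_v)\,e_{n-1}^{m-1}+i(\eta_0+\eta_v)\,e_{n-1}^{m+1}-(z_0+z_v)\,e_{n-1}^m+f_n^m\right],$$ where, writing $\mathbf{R}_s=(x_s,y_s,z_s)$, $\xi_s=\frac{x_s+iy_s}{2}$ and $\eta_s=\frac{x_s-iy_s}{2}$ for $s\in\{0,v,w\}$.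
   Context: Harmonic polynomials: for $\mathbf{r}=(x,y,z)=r(\sin\theta\cos\varphi,\sin\theta\sin\varphi,\cos\theta)\in\mathbb{R}^3$, integers $n\ge 0$ and $-n\le m\le n$, $$R_n^m(\mathbf{r})=\frac{(-1)^n i^{|m|}}{(n+|m|)!}\,r^n P_n^{|m|}(\cos\theta)\,e^{im\varphi},$$ and $R_n^m\equiv 0$ for $|m|>n$; $i$ is the imaginary unit. Each $R_n^m$ is a homogeneous polynomial of degree $n$ in $(x,y,z)$ (this defines it also at points where $\theta,\varphi$ are not uniquely defined; $R_0^0\equiv 1$). The associated Legendre functions are, for integers $n,m\ge 0$, $$P_n^m(\mu)=\frac{(-1)^m(1-\mu^2)^{m/2}}{2^n n!}\frac{d^{m+n}}{d\mu^{m+n}}(\mu^2-1)^n.$$ Accordingly all indexed quantities built from $R_n^m$ vanish when $|m|>n$. *)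

theory Defs
  imports "HOL-Analysis.Analysis"
begin

text \<open>
  Associated Legendre function, degree \<open>n\<close>, order \<open>m\<close>.  The factor
  \<open>(1 - \<mu>\<^sup>2)\<^bsup>m/2\<^esup>\<close> is written as a power of the square root, because
  \<open>0 powr 0 = 0\<close> would give the wrong value for \<open>m = 0\<close>, \<open>\<mu> = 1\<close> or \<open>\<mu> = - 1\<close>.
\<close>
definition assoc_legendre :: "nat \<Rightarrow> nat \<Rightarrow> real \<Rightarrow> real" where
  "assoc_legendre n m \<mu> =
     (- 1) ^ m * sqrt (1 - \<mu>\<^sup>2) ^ m / (2 ^ n * fact n)
       * (deriv ^^ (m + n)) (\<lambda>t. (t\<^sup>2 - 1) ^ n) \<mu>"

definition spherical_point :: "real \<Rightarrow> real \<Rightarrow> real \<Rightarrow> real ^ 3" where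
  "spherical_point r \<theta> \<phi> =
     vector [r * sin \<theta> * cos \<phi>, r * sin \<theta> * sin \<phi>, r * cos \<theta>]"

definition harmonic_spherical :: "nat \<Rightarrow> int \<Rightarrow> real \<Rightarrow> real \<Rightarrow> real \<Rightarrow> complex" where
  "harmonic_spherical n m r \<theta> \<phi> =
     (if int n < \<bar>m\<bar> then 0
      else (- 1) ^ n * \<i> ^ nat \<bar>m\<bar> / fact (n + nat \<bar>m\<bar>)
             * of_real (r ^ n * assoc_legendre n (nat \<bar>m\<bar>) (cos \<theta>))
             * exp (\<i> * of_int m * of_real \<phi>))"

text \<open>
  The harmonic polynomial \<open>R\<^sub>n\<^sup>m\<close> on all of space, by one choice of spherical
  coordinates at each point.  The choice is immaterial, also on the polar axis and at the
  origin (where \<open>p $ 3 / norm p = 0\<close> and \<open>Arg 0 = 0\<close>): see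
  \<open>harmonic_R_spherical_point\<close> below.
\<close>
definition harmonic_R :: "nat \<Rightarrow> int \<Rightarrow> real ^ 3 \<Rightarrow> complex" where
  "harmonic_R n m p =
     harmonic_spherical n m (norm p) (arccos (p $ 3 / norm p)) (Arg (Complex (p $ 1) (p $ 2)))"

lemma spherical_point_component [simp]:
  "spherical_point r \<theta> \<phi> $ 1 = r * sin \<theta> * cos \<phi>"
  "spherical_point r \<theta> \<phi> $ 2 = r * sin \<theta> * sin \<phi>"
  "spherical_point r \<theta> \<phi> $ 3 = r * cos \<theta>"
  by (simp_all add: spherical_point_def)

lemma norm_spherical_point:
  assumes "0 \<le> r"
  shows "norm (spherical_point r \<theta> \<phi>) = r"
proof -
  have "(r * sin \<theta> * cos \<phi>)\<^sup>2 + (r * sin \<theta> * sin \<phi>)\<^sup>2 + (r * cos \<theta>)\<^sup>2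
      = r\<^sup>2 * ((sin \<theta>)\<^sup>2 * ((sin \<phi>)\<^sup>2 + (cos \<phi>)\<^sup>2) + (cos \<theta>)\<^sup>2)"
    by (simp add: power_mult_distrib algebra_simps del: sin_cos_squared_add sin_cos_squared_add2)
  also have "\<dots> = r\<^sup>2" by simp
  finally show ?thesis
    using assms by (simp add: norm_vec_def L2_set_def sum_3)
qed

lemma assoc_legendre_pole:
  assumes "\<mu>\<^sup>2 = 1" "0 < m"
  shows "assoc_legendre n m \<mu> = 0"
  using assms by (simp add: assoc_legendre_def)

lemma harmonic_R_spherical_point:
  assumes r: "0 \<le> r" and \<theta>: "0 \<le> \<theta>" "\<theta> \<le> pi"
  shows "harmonic_R n m (spherical_point r \<theta> \<phi>) = harmonic_spherical n m r \<theta> \<phi>"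
proof (cases "int n < \<bar>m\<bar>")
  case True
  then show ?thesis by (simp add: harmonic_R_def harmonic_spherical_def)
next
  case mn: False
  let ?p = "spherical_point r \<theta> \<phi>"
  define \<psi> where "\<psi> = Arg (Complex (?p $ 1) (?p $ 2))"
  have R: "harmonic_R n m ?p = harmonic_spherical n m r (arccos (?p $ 3 / r)) \<psi>"
    by (simp only: harmonic_R_def norm_spherical_point[OF r] \<psi>_def)
  show ?thesis
  proof (cases "r = 0")
    case True
    show ?thesis
    proof (cases "n = 0")
      case True
      with mn have "m = 0" by simp
      with True show ?thesis
        unfolding R by (simp add: harmonic_spherical_def assoc_legendre_def)
    next
      case False
      with \<open>r = 0\<close> show ?thesis
        unfolding R by (simp add: harmonic_spherical_def)
    qed
  next
    case False
    with r have "0 < r" by simp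
    then have th: "arccos (?p $ 3 / r) = \<theta>"
      using \<theta> by (simp add: arccos_cos)
    consider "m = 0" | "m \<noteq> 0" "sin \<theta> = 0" | "sin \<theta> > 0"
      using sin_ge_zero[OF \<theta>] by fastforce
    then show ?thesis
    proof cases
      case 1
      then show ?thesis unfolding R th by (simp add: harmonic_spherical_def)
    next
      case 2
      then have "(cos \<theta>)\<^sup>2 = 1" using sin_cos_squared_add[of \<theta>] by simp
      with 2 have "assoc_legendre n (nat \<bar>m\<bar>) (cos \<theta>) = 0"
        by (intro assoc_legendre_pole) auto
      then show ?thesis unfolding R th by (simp add: harmonic_spherical_def)
    next
      case 3
      define k where "k = r * sin \<theta>"
      have "0 < k" using 3 \<open>0 < r\<close> by (simp add: k_def)
      have z: "Complex (?p $ 1) (?p $ 2) = of_real k * cis \<phi>"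
        by (simp add: complex_eq_iff k_def)
      have "cis \<psi> = sgn (of_real k * cis \<phi>)"
        unfolding \<psi>_def z using \<open>0 < k\<close> by (intro cis_Arg) simp
      also have "\<dots> = cis \<phi>"
        using \<open>0 < k\<close> by (simp add: sgn_eq norm_mult)
      finally have "cis \<psi> powi m = cis \<phi> powi m" by simp
      then have "cis (of_int m * \<psi>) = cis (of_int m * \<phi>)" by (simp add: cis_power_int)
      then have "exp (\<i> * of_int m * of_real \<psi>) = exp (\<i> * of_int m * of_real \<phi>)"
        by (simp add: cis_conv_exp mult.assoc)
      then show ?thesis unfolding R th by (simp add: harmonic_spherical_def)
    qed
  qed
qed

definition coef_c ::
  "real ^ 3 \<Rightarrow> real ^ 3 \<Rightarrow> real ^ 3 \<Rightarrow> real ^ 3 \<Rightarrow> nat \<Rightarrow> int \<Rightarrow> real \<Rightarrow> real \<Rightarrow> real \<Rightarrow> complex" where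
  "coef_c Ru Rv Rw R0 n m u v w =
     harmonic_R n m (u *\<^sub>R Ru + v *\<^sub>R Rv + w *\<^sub>R Rw + R0)"

definition coef_d ::
  "real ^ 3 \<Rightarrow> real ^ 3 \<Rightarrow> real ^ 3 \<Rightarrow> real ^ 3 \<Rightarrow> nat \<Rightarrow> int \<Rightarrow> real \<Rightarrow> real \<Rightarrow> complex" where
  "coef_d Ru Rv Rw R0 n m u v = coef_c Ru Rv Rw R0 n m u v (1 - u - v)"

definition coef_b ::
  "real ^ 3 \<Rightarrow> real ^ 3 \<Rightarrow> real ^ 3 \<Rightarrow> real ^ 3 \<Rightarrow> nat \<Rightarrow> int \<Rightarrow> complex" where
  "coef_b Ru Rv Rw R0 n m =
     integral {0..1} (\<lambda>v. integral {0..1 - v} (\<lambda>u. coef_d Ru Rv Rw R0 n m u v))"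

definition coef_e ::
  "real ^ 3 \<Rightarrow> real ^ 3 \<Rightarrow> real ^ 3 \<Rightarrow> real ^ 3 \<Rightarrow> nat \<Rightarrow> int \<Rightarrow> complex" where
  "coef_e Ru Rv Rw R0 n m = integral {0..1} (\<lambda>u. coef_d Ru Rv Rw R0 n m u (1 - u))"

definition coef_f ::
  "real ^ 3 \<Rightarrow> real ^ 3 \<Rightarrow> real ^ 3 \<Rightarrow> real ^ 3 \<Rightarrow> nat \<Rightarrow> int \<Rightarrow> complex" where
  "coef_f Ru Rv Rw R0 n m = coef_c Ru Rv Rw R0 n m 1 0 0"

definition xi :: "real ^ 3 \<Rightarrow> complex" where
  "xi p = (of_real (p $ 1) + \<i> * of_real (p $ 2)) / 2"

definition eta :: "real ^ 3 \<Rightarrow> complex" where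
  "eta p = (of_real (p $ 1) - \<i> * of_real (p $ 2)) / 2"

end

theory Submission
  imports Defs "HOL-Computational_Algebra.Polynomial"
begin

text \<open>
  The harmonic polynomial \<open>R\<^sub>n\<^sup>m(p)\<close> is the coefficient of \<open>t\<^sup>m\<close> in
  \<open>(i \<xi> t + i \<eta> / t - z)\<^sup>n / n!\<close>.  With \<open>T\<^sub>a\<close> the operator
  \<open>(T\<^sub>a g)\<^sup>m = i \<xi>\<^sub>a g\<^sup>m\<^sup>-\<^sup>1 + i \<eta>\<^sub>a g\<^sup>m\<^sup>+\<^sup>1 - z\<^sub>a g\<^sup>m\<close>, this says \<open>n R\<^sub>n = T\<^sub>p R\<^sub>n\<^sub>-\<^sub>1\<close>, which in
  terms of Legendre functions comes down to the Leibniz rule for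
  \<open>(\<mu>\<^sup>2 - 1) (\<mu>\<^sup>2 - 1)\<^sup>n\<^sup>-\<^sup>1\<close>.  As the \<open>T\<^sub>a\<close> commute, the derivative of \<open>R\<^sub>n\<close> in direction
  \<open>a\<close> is \<open>T\<^sub>a R\<^sub>n\<^sub>-\<^sub>1\<close>.  On a segment or triangle based at \<open>A\<close>, splitting \<open>p = A + (p - A)\<close>
  turns \<open>n R\<^sub>n\<close> into \<open>T\<^sub>A R\<^sub>n\<^sub>-\<^sub>1\<close> plus a radial derivative of \<open>R\<^sub>n\<close>, and the divergence theorem
  moves the latter to the boundary.
\<close>

section \<open>The recurrence in the degree\<close>

lemma higher_deriv_poly: "(deriv ^^ k) (poly p) = poly ((pderiv ^^ k) (p :: real poly))"
proof (induction k)
  case (Suc k)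
  have "deriv (poly q) = poly (pderiv q)" for q :: "real poly"
    by (rule ext) (rule DERIV_imp_deriv, rule poly_DERIV)
  with Suc show ?case by simp
qed simp

lemma higher_pderiv_linear_mult:
  fixes q :: "real poly"
  shows "(pderiv ^^ Suc k) ([:0, 1:] * q) =
    [:0, 1:] * (pderiv ^^ Suc k) q + of_nat (Suc k) * (pderiv ^^ k) q"
proof (induction k)
  case 0
  show ?case by (simp add: pderiv_mult pderiv_pCons)
next
  case (Suc k)
  have "(pderiv ^^ Suc (Suc k)) ([:0, 1:] * q) =
      pderiv ([:0, 1:] * (pderiv ^^ Suc k) q + of_nat (Suc k) * (pderiv ^^ k) q)"
    using Suc by simp
  also have "\<dots> = [:0, 1:] * (pderiv ^^ Suc (Suc k)) q
      + of_nat (Suc (Suc k)) * (pderiv ^^ Suc k) q"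
    by (simp add: pderiv_mult pderiv_add pderiv_pCons pderiv_of_nat algebra_simps)
  finally show ?case .
qed

text \<open>Leibniz's rule stops after three terms because the third derivative of t^2 - 1 is zero.
  The last coefficient is the binomial coefficient (k+2)(k+1)/2 times the second derivative 2.
  Orders 0 and 1 are left out so that no index is a truncated difference.\<close>

lemma higher_pderiv_quadratic_mult:
  fixes q :: "real poly"
  shows "(pderiv ^^ Suc (Suc k)) ([:-1, 0, 1:] * q) =
    [:-1, 0, 1:] * (pderiv ^^ Suc (Suc k)) q
    + of_nat (Suc (Suc k)) * ([:0, 2:] * (pderiv ^^ Suc k) q)
    + of_nat (Suc (Suc k) * Suc k) * (pderiv ^^ k) q"
proof (induction k)
  case 0
  have "pderiv [:-1, 0, 1::real:] = [:0, 2:]" "pderiv [:0, 2::real:] = 2"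
    by (simp_all add: pderiv_pCons flip: numeral_poly)
  then show ?case
    by (simp add: pderiv_mult pderiv_add del: mult_pCons_left mult_pCons_right)
next
  case (Suc k)
  have d: "pderiv [:-1, 0, 1::real:] = [:0, 2:]" "pderiv [:0, 2::real:] = 2"
    by (simp_all add: pderiv_pCons flip: numeral_poly)
  have "(pderiv ^^ Suc (Suc (Suc k))) ([:-1, 0, 1:] * q) =
      pderiv ((pderiv ^^ Suc (Suc k)) ([:-1, 0, 1:] * q))"
    by simp
  also have "\<dots> = pderiv ([:-1, 0, 1:] * (pderiv ^^ Suc (Suc k)) q
    + of_nat (Suc (Suc k)) * ([:0, 2:] * (pderiv ^^ Suc k) q)
    + of_nat (Suc (Suc k) * Suc k) * (pderiv ^^ k) q)"
    by (simp only: Suc)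
  also have "\<dots> = [:-1, 0, 1:] * (pderiv ^^ Suc (Suc (Suc k))) q
    + of_nat (Suc (Suc (Suc k))) * ([:0, 2:] * (pderiv ^^ Suc (Suc k)) q)
    + of_nat (Suc (Suc (Suc k)) * Suc (Suc k)) * (pderiv ^^ Suc k) q"
  proof -
    have two: "[:0, 2::real:] = 2 * [:0, 1:]" by (simp add: numeral_poly)
    show ?thesis
      by (simp only: funpow.simps o_apply pderiv_add pderiv_mult d pderiv_of_nat pderiv_1 of_nat_mult of_nat_Suc)
        (simp only: two, algebra)
  qed
  finally show ?case .
qed

section \<open>Legendre functions from derivatives of (t^2 - 1)^n\<close>

definition rodrigues :: "nat \<Rightarrow> nat \<Rightarrow> real \<Rightarrow> real" where
  "rodrigues n k t = poly ((pderiv ^^ k) ([:-1, 0, 1:] ^ n)) t"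

lemma assoc_legendre_rodrigues:
  "assoc_legendre n m \<mu> =
     (- sqrt (1 - \<mu>\<^sup>2)) ^ m / (2 ^ n * fact n) * rodrigues n (m + n) \<mu>"
proof -
  have "(\<lambda>t. (t\<^sup>2 - 1) ^ n) = poly ([:-1, 0, 1::real:] ^ n)"
    by (rule ext) (simp add: power2_eq_square poly_power)
  then show ?thesis
    by (simp add: assoc_legendre_def rodrigues_def higher_deriv_poly flip: power_mult_distrib)
qed

text \<open>Leibniz's rule after splitting one factor t^2 - 1 off (t^2 - 1)^(n+1). The three terms
  become the three neighbouring orders in the Legendre recurrences.\<close>

lemma rodrigues_Suc:
  "rodrigues (Suc n) (Suc (Suc k)) t =
     (t\<^sup>2 - 1) * rodrigues n (Suc (Suc k)) t
     + 2 * real (Suc (Suc k)) * t * rodrigues n (Suc k) t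
     + real (Suc (Suc k)) * real (Suc k) * rodrigues n k t"
proof -
  have "rodrigues (Suc n) (Suc (Suc k)) t =
      poly ((pderiv ^^ Suc (Suc k)) ([:-1, 0, 1:] * [:-1, 0, 1:] ^ n)) t"
    by (simp add: rodrigues_def)
  also have "\<dots> = (t\<^sup>2 - 1) * rodrigues n (Suc (Suc k)) t
     + 2 * real (Suc (Suc k)) * t * rodrigues n (Suc k) t
     + real (Suc (Suc k)) * real (Suc k) * rodrigues n k t"
    unfolding higher_pderiv_quadratic_mult rodrigues_def
    by (simp only: poly_add poly_mult poly_of_nat of_nat_mult) (simp add: power2_eq_square algebra_simps)
  finally show ?thesis .
qed

text \<open>
  Differentiating \<open>(t\<^sup>2 - 1) W' = 2 n t W\<close>, where \<open>W = (t\<^sup>2 - 1)\<^sup>n\<close>, \<open>n\<close> times.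
\<close>
lemma rodrigues_reflect:
  "(t\<^sup>2 - 1) * rodrigues (Suc n) (Suc (Suc n)) t =
     real (Suc n) * real (Suc (Suc n)) * rodrigues (Suc n) n t"
proof (cases n)
  case 0
  then show ?thesis
    by (simp add: rodrigues_def pderiv_pCons power2_eq_square numeral_2_eq_2)
next
  case (Suc j)
  let ?W = "[:-1, 0, 1::real:] ^ Suc n"
  have two: "[:0, 2::real:] = 2 * [:0, 1:]" by (simp add: numeral_poly)
  have "pderiv ?W = of_nat (Suc n) * ([:-1, 0, 1:] ^ n * [:0, 2:])"
    by (subst pderiv_power_Suc) (simp add: pderiv_pCons of_nat_poly)
  then have ode: "[:-1, 0, 1:] * pderiv ?W = of_nat (2 * Suc n) * ([:0, 1:] * ?W)"
    unfolding two by (simp only: power_Suc of_nat_mult of_nat_numeral mult_ac)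
  have c: "(pderiv ^^ k) (of_nat a * p) = of_nat a * (pderiv ^^ k) p" for k a and p :: "real poly"
    by (induction k) (simp_all add: pderiv_mult)
  have s: "(pderiv ^^ k) (pderiv p) = (pderiv ^^ Suc k) p" for k and p :: "real poly"
    by (simp only: funpow_Suc_right o_apply)
  have "poly ((pderiv ^^ Suc (Suc j)) ([:-1, 0, 1:] * pderiv ?W)) t =
      poly (of_nat (2 * Suc n) * (pderiv ^^ Suc (Suc j)) ([:0, 1:] * ?W)) t"
    by (simp only: ode c)
  then have "(t\<^sup>2 - 1) * rodrigues (Suc n) (Suc (Suc (Suc j))) t
       + 2 * real (Suc (Suc j)) * t * rodrigues (Suc n) (Suc (Suc j)) t
       + real (Suc (Suc j)) * real (Suc j) * rodrigues (Suc n) (Suc j) t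
     = 2 * real (Suc n) * (t * rodrigues (Suc n) (Suc (Suc j)) t
       + real (Suc (Suc j)) * rodrigues (Suc n) (Suc j) t)"
    unfolding higher_pderiv_quadratic_mult higher_pderiv_linear_mult s rodrigues_def
    by (simp only: poly_add poly_mult poly_of_nat of_nat_mult)
      (simp add: power2_eq_square algebra_simps del: power_Suc funpow.simps)
  \<comment> \<open>Since \<open>Suc n\<close> is j + 2, the terms in t cancel. The rest has
    coefficient 2(j+2)(j+2) - (j+2)(j+1) = (j+2)(j+3).\<close>
  then show ?thesis
    unfolding Suc by (simp add: algebra_simps)
qed

text \<open>This is \<open>rodrigues_Suc\<close> with k = n + m, multiplied by the power of the
  square root. The bound on the argument makes the square of the root equal to 1 - t^2, which shifts
  that power between neighbouring orders.\<close>

lemma assoc_legendre_recurrence: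
  assumes "\<bar>\<mu>\<bar> \<le> 1"
  shows "2 * real (Suc n) * assoc_legendre (Suc n) (Suc m) \<mu> =
    sqrt (1 - \<mu>\<^sup>2) * (assoc_legendre n (Suc (Suc m)) \<mu>
        - real (n + m + 2) * real (n + m + 1) * assoc_legendre n m \<mu>)
    + 2 * \<mu> * real (n + m + 2) * assoc_legendre n (Suc m) \<mu>"
proof -
  define s where "s = sqrt (1 - \<mu>\<^sup>2)"
  have s2: "\<mu>\<^sup>2 - 1 = - (s * s)"
    using assms by (simp add: s_def abs_square_le_1)
  define c where "c = (2 ^ n * fact n :: real)"
  have c: "c \<noteq> 0" "2 ^ Suc n * fact (Suc n) = 2 * real (Suc n) * c"
    by (simp_all add: c_def)
  have L: "assoc_legendre n k \<mu> = (- s) ^ k / c * rodrigues n (k + n) \<mu>" for k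
    by (simp add: assoc_legendre_rodrigues s_def c_def)
  have "2 * real (Suc n) * assoc_legendre (Suc n) (Suc m) \<mu> =
      (- s) ^ Suc m / c * rodrigues (Suc n) (Suc (Suc (n + m))) \<mu>"
    using c(1) by (simp only: assoc_legendre_rodrigues c(2) flip: s_def) (simp add: add_ac)
  also have "\<dots> = s * (assoc_legendre n (Suc (Suc m)) \<mu>
        - real (n + m + 2) * real (n + m + 1) * assoc_legendre n m \<mu>)
    + 2 * \<mu> * real (n + m + 2) * assoc_legendre n (Suc m) \<mu>"
    unfolding rodrigues_Suc L s2 using c(1) by (simp add: field_simps)
  finally show ?thesis by (simp add: s_def)
qed

text \<open>At order 0 the lower neighbour would have order -1, that is, n - 1 derivatives of (t^2 -
  1)^n. \<open>rodrigues_reflect\<close> turns this term into a second copy of the order 1 term. For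
  n = 0 no such derivative exists, hence the separate case.\<close>

lemma legendre_recurrence:
  assumes "\<bar>\<mu>\<bar> \<le> 1"
  shows "real (Suc n) * assoc_legendre (Suc n) 0 \<mu> =
    sqrt (1 - \<mu>\<^sup>2) * assoc_legendre n 1 \<mu> + real (Suc n) * \<mu> * assoc_legendre n 0 \<mu>"
proof (cases n)
  case 0
  then show ?thesis
    by (simp add: assoc_legendre_rodrigues rodrigues_def pderiv_pCons)
next
  case (Suc k)
  define s where "s = sqrt (1 - \<mu>\<^sup>2)"
  have s2: "s * s = - (\<mu>\<^sup>2 - 1)"
    using assms by (simp add: s_def abs_square_le_1)
  define c where "c = (2 ^ n * fact n :: real)"
  have c: "c \<noteq> 0" "2 ^ Suc n * fact (Suc n) = 2 * real (Suc n) * c"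
    by (simp_all add: c_def)
  have L: "assoc_legendre n k \<mu> = (- s) ^ k / c * rodrigues n (k + n) \<mu>" for k
    by (simp add: assoc_legendre_rodrigues s_def c_def)
  have "2 * real (Suc n) * assoc_legendre (Suc n) 0 \<mu> =
      rodrigues (Suc n) (Suc (Suc k)) \<mu> / c"
    using c(1) by (simp only: assoc_legendre_rodrigues c(2)) (simp add: Suc)
  also have "\<dots> = (2 * ((\<mu>\<^sup>2 - 1) * rodrigues n (Suc n) \<mu>)
      + 2 * real (Suc n) * \<mu> * rodrigues n n \<mu>) / c"
    using rodrigues_reflect[of \<mu> k] unfolding rodrigues_Suc Suc by (simp add: algebra_simps)
  also have "\<dots> = 2 * (- (s * s) * rodrigues n (Suc n) \<mu> / c) +
      2 * (real (Suc n) * \<mu> * rodrigues n n \<mu> / c)"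
    by (simp only: s2 add_divide_distrib minus_minus times_divide_eq_right mult.assoc)
  also have "\<dots> = 2 * (s * assoc_legendre n 1 \<mu> + real (Suc n) * \<mu> * assoc_legendre n 0 \<mu>)"
    unfolding L by simp
  finally have "2 * (real (Suc n) * assoc_legendre (Suc n) 0 \<mu>) =
      2 * (s * assoc_legendre n 1 \<mu> + real (Suc n) * \<mu> * assoc_legendre n 0 \<mu>)"
    by (simp only: mult.assoc)
  then show ?thesis
    unfolding s_def by (subst (asm) mult_left_cancel) simp_all
qed

text \<open>The polynomial has degree 2n. Hence Legendre functions of order above n vanish, and the
  closed formula for the harmonics agrees with the convention that they are zero there.\<close>

lemma rodrigues_eq_0:
  assumes "2 * n < k"
  shows "rodrigues n k t = 0"
proof -
  have "degree ((pderiv ^^ j) p) = degree p - j" for j and p :: "real poly"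
    by (induction j) (simp_all add: degree_pderiv)
  moreover obtain j where k: "k = Suc j" "2 * n \<le> j"
    using assms by (cases k) auto
  moreover have "degree ([:-1, 0, 1::real:] ^ n) = 2 * n"
    by (simp add: degree_power_eq)
  ultimately have "degree ((pderiv ^^ j) ([:-1, 0, 1::real:] ^ n)) = 0"
    by simp
  then have "(pderiv ^^ k) ([:-1, 0, 1::real:] ^ n) = 0"
    by (simp add: k(1) pderiv_eq_0_iff)
  then show ?thesis by (simp add: rodrigues_def)
qed

section \<open>The recurrence in spherical coordinates\<close>

lemma harmonic_spherical_int:
  "harmonic_spherical n (int k) r \<theta> \<phi> =
     (- 1) ^ n * \<i> ^ k / fact (n + k) * of_real (r ^ n * assoc_legendre n k (cos \<theta>))
       * exp (\<i> * of_real \<phi>) ^ k"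
proof -
  have "exp (\<i> * of_real \<phi>) ^ k = exp (\<i> * of_int (int k) * of_real \<phi>)"
    by (simp add: mult_ac flip: exp_of_nat_mult)
  then show ?thesis
    by (simp add: harmonic_spherical_def assoc_legendre_rodrigues rodrigues_eq_0)
qed

lemma harmonic_spherical_uminus:
  "harmonic_spherical n (- m) r \<theta> \<phi> = harmonic_spherical n m r \<theta> (- \<phi>)"
  by (simp add: harmonic_spherical_def)

lemma harmonic_spherical_Suc_int:
  assumes "0 \<le> \<theta>" "\<theta> \<le> pi"
  shows "of_nat (Suc n) * harmonic_spherical (Suc n) (int k) r \<theta> \<phi> =
    \<i> * (of_real (r * sin \<theta>) * exp (\<i> * of_real \<phi>) / 2) * harmonic_spherical n (int k - 1) r \<theta> \<phi>
    + \<i> * (of_real (r * sin \<theta>) * exp (- \<i> * of_real \<phi>) / 2) * harmonic_spherical n (int k + 1) r \<theta> \<phi>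
    - of_real (r * cos \<theta>) * harmonic_spherical n (int k) r \<theta> \<phi>"
proof -
  define E where "E = exp (\<i> * of_real \<phi>)"
  have E0: "E \<noteq> 0" by (simp add: E_def)
  have E': "exp (- \<i> * of_real \<phi>) = inverse E" "exp (\<i> * of_real (- \<phi>)) = inverse E"
    by (simp_all add: E_def exp_minus)
  define s where "s = complex_of_real (sin \<theta>)"
  define c where "c = complex_of_real (cos \<theta>)"
  define L where "L = (\<lambda>n k. complex_of_real (assoc_legendre n k (cos \<theta>)))"
  have sin: "sqrt (1 - (cos \<theta>)\<^sup>2) = sin \<theta>"
    using sin_ge_zero[OF assms] by (simp add: sin_squared_eq[symmetric])
  show ?thesis
  proof (cases k)
    case 0
    have rec: "of_nat (Suc n) * L (Suc n) 0 = s * L n 1 + of_nat (Suc n) * c * L n 0"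
      using arg_cong[OF legendre_recurrence[OF abs_cos_le_one, of n \<theta>], of complex_of_real]
      unfolding sin by (simp add: L_def s_def c_def)
    define X where "X = (- 1) ^ n * of_real r ^ Suc n / (fact (Suc n) :: complex)"
    have X: "(- 1) ^ n * of_real r ^ Suc n / (fact n :: complex) = of_nat (Suc n) * X"
      by (simp add: X_def del: of_nat_Suc)
    \<comment> \<open>Order -1 is order 1 with the azimuth negated. Its factor
      \<open>inverse E\<close> cancels the \<open>E\<close> in front of it, so both neighbours of
      order 0 contribute the same amount.\<close>
    have h1: "harmonic_spherical n (int k - 1) r \<theta> \<phi> =
        (- 1) ^ n * \<i> / fact (Suc n) * of_real r ^ n * L n 1 * inverse E"
      using harmonic_spherical_uminus[of n "int 1" r \<theta> \<phi>]
      unfolding harmonic_spherical_int 0 E' by (simp add: L_def)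
    have h2: "harmonic_spherical n (int k + 1) r \<theta> \<phi> =
        (- 1) ^ n * \<i> / fact (Suc n) * of_real r ^ n * L n 1 * E"
      using harmonic_spherical_int[of n 1 r \<theta> \<phi>]
      unfolding 0 by (simp add: L_def E_def)
    have "of_nat (Suc n) * harmonic_spherical (Suc n) (int k) r \<theta> \<phi> =
        - X * (of_nat (Suc n) * L (Suc n) 0)"
      unfolding harmonic_spherical_int 0 by (simp add: L_def X_def)
    also have "\<dots> = - X * s * L n 1 - c * L n 0 * (of_nat (Suc n) * X)"
      unfolding rec by (simp add: algebra_simps)
    also have "\<dots> = \<i> * (of_real (r * sin \<theta>) * E / 2) * harmonic_spherical n (int k - 1) r \<theta> \<phi>
      + \<i> * (of_real (r * sin \<theta>) * inverse E / 2) * harmonic_spherical n (int k + 1) r \<theta> \<phi>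
      - of_real (r * cos \<theta>) * harmonic_spherical n (int k) r \<theta> \<phi>"
    proof -
      have "\<i> * (of_real (r * sin \<theta>) * E / 2) * harmonic_spherical n (int k - 1) r \<theta> \<phi>
          = - (X * s * L n 1) / 2"
        unfolding h1 using E0 by (simp add: X_def s_def field_simps del: of_nat_Suc fact_Suc)
      moreover have "\<i> * (of_real (r * sin \<theta>) * inverse E / 2) * harmonic_spherical n (int k + 1) r \<theta> \<phi>
          = - (X * s * L n 1) / 2"
        unfolding h2 using E0 by (simp add: X_def s_def field_simps del: of_nat_Suc fact_Suc)
      moreover have "of_real (r * cos \<theta>) * harmonic_spherical n (int k) r \<theta> \<phi>
          = c * L n 0 * (of_nat (Suc n) * X)"
        unfolding harmonic_spherical_int 0 X[symmetric] by (simp add: c_def L_def)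
      ultimately show ?thesis by simp
    qed
    finally show ?thesis by (simp only: E' E_def[symmetric])
  next
    case (Suc j)
    define a b where "a = (of_nat (n + j + 2) :: complex)" and "b = (of_nat (n + j + 1) :: complex)"
    have rec: "2 * of_nat (Suc n) * L (Suc n) (Suc j) =
        s * (L n (Suc (Suc j)) - a * b * L n j) + 2 * c * a * L n (Suc j)"
      using arg_cong[OF assoc_legendre_recurrence[OF abs_cos_le_one, of n j \<theta>], of complex_of_real]
      unfolding sin by (simp add: L_def s_def c_def a_def b_def)
    \<comment> \<open>\<open>X\<close> is the common factor of all four products. Its factorial is
      the largest one occurring; the smaller ones leave the factors \<open>a\<close> and
      \<open>b\<close> of the Legendre recurrence.\<close>
    define X where "X = (- 1) ^ n * of_real r ^ Suc n * \<i> ^ Suc j * E ^ Suc j / fact (n + j + 2)"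
    have ab: "a \<noteq> 0" "b \<noteq> 0"
      unfolding a_def b_def of_nat_eq_0_iff by simp_all
    have f: "fact (n + j + 2) = a * b * fact (n + j)" "fact (n + Suc j) = b * fact (n + j)"
      by (simp_all add: a_def b_def numeral_2_eq_2 algebra_simps)
    have f': "n + Suc (Suc j) = n + j + 2" "Suc n + Suc j = n + j + 2" by simp_all
    have k: "int k - 1 = int j" "int k + 1 = int (Suc (Suc j))"
      using Suc by simp_all
    have h1: "of_nat (Suc n) * harmonic_spherical (Suc n) (int k) r \<theta> \<phi> =
        - X / 2 * (2 * of_nat (Suc n) * L (Suc n) (Suc j))"
      unfolding harmonic_spherical_int Suc f' X_def L_def E_def
      by (simp add: field_simps del: fact_Suc of_nat_Suc)
    have h2: "\<i> * (of_real (r * sin \<theta>) * E / 2) * harmonic_spherical n (int k - 1) r \<theta> \<phi>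
        = X * s / 2 * (a * b * L n j)"
      unfolding k harmonic_spherical_int X_def L_def E_def[symmetric] s_def f
      using ab by (simp add: field_simps)
    have h3: "\<i> * (of_real (r * sin \<theta>) * inverse E / 2) * harmonic_spherical n (int k + 1) r \<theta> \<phi>
        = - X * s / 2 * L n (Suc (Suc j))"
      unfolding k harmonic_spherical_int X_def L_def E_def[symmetric] s_def f'
      using E0 by (simp add: field_simps del: fact_Suc)
    have h4: "of_real (r * cos \<theta>) * harmonic_spherical n (int k) r \<theta> \<phi>
        = X * c * a * L n (Suc j)"
      unfolding Suc harmonic_spherical_int X_def L_def E_def[symmetric] c_def f
      using ab by (simp add: field_simps)
    show ?thesis
      unfolding E' E_def[symmetric] h1 h2 h3 h4 rec
      by (simp add: algebra_simps diff_divide_distrib add_divide_distrib)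
  qed
qed

text \<open>Negating both order and azimuth reduces negative orders to nonnegative ones. It
  exchanges the two neighbour terms together with their exponentials.\<close>

lemma harmonic_spherical_Suc:
  assumes "0 \<le> \<theta>" "\<theta> \<le> pi"
  shows "of_nat (Suc n) * harmonic_spherical (Suc n) m r \<theta> \<phi> =
    \<i> * (of_real (r * sin \<theta>) * exp (\<i> * of_real \<phi>) / 2) * harmonic_spherical n (m - 1) r \<theta> \<phi>
    + \<i> * (of_real (r * sin \<theta>) * exp (- \<i> * of_real \<phi>) / 2) * harmonic_spherical n (m + 1) r \<theta> \<phi>
    - of_real (r * cos \<theta>) * harmonic_spherical n m r \<theta> \<phi>"
proof (cases "0 \<le> m")
  case True
  then show ?thesis
    using harmonic_spherical_Suc_int[OF assms, of n "nat m" r \<phi>] by simp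
next
  case False
  then obtain k where m: "m = - int k"
    by (metis int_cases2 of_nat_0_le_iff)
  have "m - 1 = - (int k + 1)" "m + 1 = - (int k - 1)"
    using m by simp_all
  then show ?thesis
    using harmonic_spherical_Suc_int[OF assms, of n k r "- \<phi>"]
    by (simp only: m harmonic_spherical_uminus) (simp add: add.commute)
qed

section \<open>The harmonic polynomials and their derivatives\<close>

text \<open>On Laurent series with coefficients \<open>g m\<close>, this is multiplication by i xi t
  + i eta / t - z. This explains linearity in \<open>a\<close> and commutation.\<close>

definition ladder :: "real ^ 3 \<Rightarrow> (int \<Rightarrow> complex) \<Rightarrow> int \<Rightarrow> complex" where
  "ladder a g m = \<i> * xi a * g (m - 1) + \<i> * eta a * g (m + 1) - of_real (a $ 3) * g m"

lemma ladder_add: "ladder (a + b) g m = ladder a g m + ladder b g m"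
  by (simp add: ladder_def xi_def eta_def algebra_simps add_divide_distrib diff_divide_distrib)

lemma ladder_scaleR: "ladder (c *\<^sub>R a) g m = of_real c * ladder a g m"
  by (simp add: ladder_def xi_def eta_def algebra_simps add_divide_distrib diff_divide_distrib)

lemma ladder_commute: "ladder a (ladder b g) m = ladder b (ladder a g) m"
  by (simp add: ladder_def algebra_simps)

lemma ladder_mult: "ladder a (\<lambda>m. c * g m) m = c * ladder a g m"
  by (simp add: ladder_def algebra_simps)

lemma harmonic_R_0: "harmonic_R 0 m p = (if m = 0 then 1 else 0)"
  by (simp add: harmonic_R_def harmonic_spherical_def assoc_legendre_def)

lemma harmonic_R_Suc:
  "of_nat (Suc n) * harmonic_R (Suc n) m p = ladder p (\<lambda>m. harmonic_R n m p) m"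
proof -
  define r \<phi> where "r = norm p" and "\<phi> = Arg (Complex (p $ 1) (p $ 2))"
  define \<theta> where "\<theta> = arccos (p $ 3 / r)"
  let ?w = "Complex (p $ 1) (p $ 2)"
  have le: "\<bar>p $ 3 / r\<bar> \<le> 1"
    using component_le_norm_cart[of p 3] by (simp add: r_def divide_le_eq_1)
  then have \<theta>: "0 \<le> \<theta>" "\<theta> \<le> pi"
    unfolding \<theta>_def abs_le_iff by (intro arccos_lbound arccos_ubound; linarith)+
  \<comment> \<open>At the origin the quotient is 0 / 0 = 0, and both sides vanish.\<close>
  have z: "r * cos \<theta> = p $ 3"
    using le component_le_norm_cart[of p 3] by (auto simp: \<theta>_def cos_arccos_abs r_def)
  have r2: "r\<^sup>2 = (p $ 1)\<^sup>2 + (p $ 2)\<^sup>2 + (p $ 3)\<^sup>2"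
    by (simp add: r_def norm_vec_def L2_set_def sum_3)
  have "(r * sin \<theta>)\<^sup>2 = r\<^sup>2 - (r * cos \<theta>)\<^sup>2"
    by (simp add: power_mult_distrib sin_squared_eq algebra_simps)
  also have "\<dots> = (cmod ?w)\<^sup>2"
    by (simp add: r2 z cmod_power2)
  finally have "(r * sin \<theta>)\<^sup>2 = (cmod ?w)\<^sup>2" .
  then have rs: "r * sin \<theta> = cmod ?w"
    by (rule power2_eq_imp_eq) (use sin_ge_zero[OF \<theta>] in \<open>simp_all add: r_def\<close>)
  have w: "of_real (r * sin \<theta>) * exp (\<i> * of_real \<phi>) = ?w"
    unfolding rs \<phi>_def by (metis rcis_cmod_Arg rcis_def cis_conv_exp)
  have "of_real (r * sin \<theta>) * exp (- \<i> * of_real \<phi>) = cnj (of_real (r * sin \<theta>) * exp (\<i> * of_real \<phi>))"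
    by (simp add: exp_cnj)
  then have xy: "of_real (r * sin \<theta>) * exp (\<i> * of_real \<phi>) / 2 = xi p"
      "of_real (r * sin \<theta>) * exp (- \<i> * of_real \<phi>) / 2 = eta p"
    unfolding w by (simp_all add: xi_def eta_def complex_eq_iff)
  show ?thesis
    using harmonic_spherical_Suc[OF \<theta>, of n m r \<phi>]
    unfolding xy z ladder_def harmonic_R_def by (simp add: r_def \<phi>_def \<theta>_def)
qed

lemma harmonic_R_Suc':
  "harmonic_R (Suc n) m p = ladder p (\<lambda>m. harmonic_R n m p) m / of_nat (Suc n)"
  using harmonic_R_Suc[of n m p] by (simp add: field_simps del: of_nat_Suc)

lemma continuous_on_ladder:
  assumes "continuous_on S f" "\<And>m. continuous_on S (g m)"
  shows "continuous_on S (\<lambda>x. ladder (f x) (\<lambda>m. g m x) m)"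
  unfolding ladder_def xi_def eta_def by (intro continuous_intros assms) simp_all

text \<open>The defining formula passes through the discontinuous \<open>Arg\<close>, so continuity
  comes from induction on the degree through the recurrence.\<close>

lemma continuous_on_harmonic_R [continuous_intros]:
  assumes "continuous_on S f"
  shows "continuous_on S (\<lambda>x. harmonic_R n m (f x))"
proof (induction n arbitrary: m)
  case 0
  show ?case by (simp add: harmonic_R_0)
next
  case (Suc n)
  then show ?case
    unfolding harmonic_R_Suc' by (intro continuous_on_divide continuous_on_ladder assms continuous_intros)
      (auto simp del: of_nat_Suc)
qed

lemma has_vector_derivative_ladder:
  assumes "(f has_vector_derivative f') (at t)"
    and "\<And>m. ((\<lambda>t. g t m) has_vector_derivative g' m) (at t)"
  shows "((\<lambda>t. ladder (f t) (g t) m) has_vector_derivative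
    ladder f' (g t) m + ladder (f t) g' m) (at t)"
proof -
  have c: "((\<lambda>t. of_real (f t $ i) :: complex) has_vector_derivative of_real (f' $ i)) (at t)" for i
    using bounded_linear.has_vector_derivative[OF bounded_linear_compose[OF bounded_linear_of_real bounded_linear_vec_nth] assms(1)] .
  show ?thesis
    unfolding ladder_def xi_def eta_def
    by (rule derivative_eq_intros has_vector_derivative_mult assms(2) c refl)+ 
      (simp add: algebra_simps)
qed

text \<open>Differentiating the recurrence gives \<open>ladder a\<close> of the previous degree plus
  \<open>ladder (f t)\<close> of the inductive derivative. After commuting, the latter is n + 1
  further copies of the former, and the sum n + 2 cancels the denominator.\<close>

lemma has_vector_derivative_harmonic_R:
  assumes f: "(f has_vector_derivative a) (at t)"
  shows "((\<lambda>t. harmonic_R (Suc n) m (f t)) has_vector_derivative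
    ladder a (\<lambda>m. harmonic_R n m (f t)) m) (at t)"
proof (induction n arbitrary: m)
  case 0
  have "((\<lambda>t. ladder (f t) (\<lambda>m. harmonic_R 0 m (f t)) m) has_vector_derivative
      ladder a (\<lambda>m. harmonic_R 0 m (f t)) m + ladder (f t) (\<lambda>m. 0) m) (at t)"
    by (rule has_vector_derivative_ladder[OF f]) (simp add: harmonic_R_0)
  then show ?case
    by (simp add: harmonic_R_Suc') (simp add: ladder_def)
next
  case (Suc n)
  let ?R = "\<lambda>n m. harmonic_R n m (f t)"
  have "((\<lambda>t. ladder (f t) (\<lambda>m. harmonic_R (Suc n) m (f t)) m) has_vector_derivative
      ladder a (?R (Suc n)) m + ladder (f t) (ladder a (?R n)) m) (at t)"
    using has_vector_derivative_ladder[OF f Suc] .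
  also have "ladder (f t) (ladder a (?R n)) m = of_nat (Suc n) * ladder a (?R (Suc n)) m"
    unfolding ladder_commute[of "f t"] ladder_mult[symmetric]
    by (rule arg_cong[of _ _ "\<lambda>g. ladder a g m"], rule ext) (rule harmonic_R_Suc[symmetric])
  also have "ladder a (?R (Suc n)) m + of_nat (Suc n) * ladder a (?R (Suc n)) m
      = of_nat (Suc (Suc n)) * ladder a (?R (Suc n)) m"
    by (simp add: algebra_simps)
  finally have "((\<lambda>t. ladder (f t) (\<lambda>m. harmonic_R (Suc n) m (f t)) m / of_nat (Suc (Suc n)))
      has_vector_derivative (of_nat (Suc (Suc n)) * ladder a (?R (Suc n)) m) / of_nat (Suc (Suc n))) (at t)"
    by (rule has_vector_derivative_divide)
  moreover have "(of_nat (Suc (Suc n)) * ladder a (?R (Suc n)) m) / of_nat (Suc (Suc n)) = ladder a (?R (Suc n)) m"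
    by (simp del: of_nat_Suc)
  ultimately show ?case
    unfolding harmonic_R_Suc'[of "Suc n"] by simp
qed

section \<open>Integration over segments and triangles\<close>

lemma has_integral_ladder:
  assumes "\<And>m. ((\<lambda>x. g x m) has_integral I m) S"
  shows "((\<lambda>x. ladder a (g x) m) has_integral ladder a I m) S"
  unfolding ladder_def
  by (intro has_integral_add has_integral_diff has_integral_mult_right assms)

text \<open>Integrate the derivative of t R(A + t B). The factor t removes the boundary term at
  \<open>A\<close>, and t B = (A + t B) - A turns the directional derivative into n + 1 copies of R
  minus the \<open>ladder A\<close> term.\<close>

lemma segment_recurrence:
  fixes A B :: "real ^ 3" and n :: nat
  defines "I \<equiv> \<lambda>n m. integral {0..1} (\<lambda>t. harmonic_R n m (A + t *\<^sub>R B))"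
  shows "of_nat (n + 2) * I (Suc n) m = ladder A (I n) m + harmonic_R (Suc n) m (A + B)"
proof -
  let ?R = "\<lambda>n m t. harmonic_R n m (A + t *\<^sub>R B)"
  have I: "(?R n m has_integral I n m) {0..1}" for n m
    unfolding I_def
    by (intro integrable_integral integrable_continuous_real continuous_intros)
  have deriv: "((\<lambda>t. of_real t * ?R (Suc n) m t) has_vector_derivative
      of_nat (n + 2) * ?R (Suc n) m t - ladder A (\<lambda>m. ?R n m t) m) (at t)" for t
  proof -
    have "((\<lambda>t. of_real t :: complex) has_vector_derivative 1) (at t)"
      using has_vector_derivative_of_real[OF DERIV_ident] by simp
    moreover have "((\<lambda>t. A + t *\<^sub>R B) has_vector_derivative B) (at t)"
      by (auto intro!: derivative_eq_intros)
    ultimately have "((\<lambda>t. of_real t * ?R (Suc n) m t) has_vector_derivative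
        of_real t * ladder B (\<lambda>m. ?R n m t) m + 1 * ?R (Suc n) m t) (at t)"
      by (intro has_vector_derivative_mult has_vector_derivative_harmonic_R)
    moreover have "of_nat (Suc n) * ?R (Suc n) m t
        = ladder A (\<lambda>m. ?R n m t) m + of_real t * ladder B (\<lambda>m. ?R n m t) m"
      by (simp only: harmonic_R_Suc ladder_add ladder_scaleR)
    then have "of_real t * ladder B (\<lambda>m. ?R n m t) m + 1 * ?R (Suc n) m t
        = of_nat (n + 2) * ?R (Suc n) m t - ladder A (\<lambda>m. ?R n m t) m"
      by (simp add: algebra_simps)
    ultimately show ?thesis by (simp only:)
  qed
  have "((\<lambda>t. of_nat (n + 2) * ?R (Suc n) m t - ladder A (\<lambda>m. ?R n m t) m) has_integral
      of_real 1 * ?R (Suc n) m 1 - of_real 0 * ?R (Suc n) m 0) {0..1}"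
    by (rule fundamental_theorem_of_calculus[OF zero_le_one has_vector_derivative_at_within[OF deriv]])
  moreover have "((\<lambda>t. of_nat (n + 2) * ?R (Suc n) m t - ladder A (\<lambda>m. ?R n m t) m) has_integral
      of_nat (n + 2) * I (Suc n) m - ladder A (I n) m) {0..1}"
    by (intro has_integral_diff has_integral_mult_right has_integral_ladder I)
  ultimately have "of_real 1 * ?R (Suc n) m 1 - of_real 0 * ?R (Suc n) m 0 =
      of_nat (n + 2) * I (Suc n) m - ladder A (I n) m"
    by (rule has_integral_unique)
  then show ?thesis by (simp del: of_nat_add)
qed

text \<open>The degenerate case \<open>c = 0\<close> is included because the slice of the triangle
  at v = 1 is a point.\<close>

lemma integral_rescale_unit_interval:
  fixes f :: "real \<Rightarrow> 'a :: euclidean_space"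
  assumes "0 \<le> c" "continuous_on {0..c} f"
  shows "integral {0..c} f = integral {0..1} (\<lambda>s. c *\<^sub>R f (c * s))"
proof -
  have "((\<lambda>s. c *\<^sub>R f (c * s)) has_integral integral {c * 0..c * 1} f) {0..1}"
    using assms
    by (intro has_integral_substitution[where c = 0 and d = c])
      (auto intro!: derivative_eq_intros mult_left_le)
  then show ?thesis by (simp add: has_integral_iff)
qed

lemma integral_reflect_unit_interval:
  fixes f :: "real \<Rightarrow> 'a :: euclidean_space"
  assumes "continuous_on {0..1} f"
  shows "integral {0..1} (\<lambda>t. f (1 - t)) = integral {0..1} f"
proof -
  have "((\<lambda>t. (- 1) *\<^sub>R f (1 - t)) has_integral
      integral {1 - 0..1 - 1} f - integral {1 - 1..1 - 0} f) {0..1}"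
    using assms
    by (intro has_integral_substitution_general[of "{}" _ _ _ 0 1])
      (auto intro!: derivative_eq_intros continuous_intros)
  then have "((\<lambda>t. - f (1 - t)) has_integral - integral {0..1} f) {0..1}"
    by simp
  then show ?thesis
    unfolding has_integral_neg_iff by (simp add: has_integral_iff)
qed

text \<open>
  The substitution \<open>u = (1 - v) s\<close> maps the triangle to the unit square and turns the
  divergence of \<open>R (u, v)\<close> on the triangle into \<open>P + Q\<close> below, with \<open>P\<close> an \<open>s\<close>-derivative
  and \<open>Q\<close> a \<open>v\<close>-derivative.
\<close>
lemma triangle_recurrence:
  fixes A B C :: "real ^ 3" and n :: nat
  defines "I \<equiv> \<lambda>n m. integral {0..1} (\<lambda>v. integral {0..1 - v}
                (\<lambda>u. harmonic_R n m (A + u *\<^sub>R B + v *\<^sub>R C)))"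
  shows "of_nat (n + 3) * I (Suc n) m = ladder A (I n) m
    + integral {0..1} (\<lambda>u. harmonic_R (Suc n) m (A + u *\<^sub>R B + (1 - u) *\<^sub>R C))"
proof -
  define h where "h n m s v = harmonic_R n m (A + ((1 - v) * s) *\<^sub>R B + v *\<^sub>R C)" for n m s v
  \<comment> \<open>The factor 1 - v is the Jacobian of u = (1 - v) s.\<close>
  define J where "J n m v = integral {0..1} (\<lambda>s. of_real (1 - v) * h n m s v)" for n m v
  \<comment> \<open>\<open>P\<close> is the s-derivative of s h and \<open>Q\<close> the
    v-derivative of v (1 - v) h. Moving v at fixed s also moves u, hence the direction
    \<open>C - s *\<^sub>R B\<close>.\<close>
  define P where "P s v = h (Suc n) m s v + of_real s * ladder ((1 - v) *\<^sub>R B) (\<lambda>m. h n m s v) m" for s v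
  define Q where "Q s v = of_real (1 - 2 * v) * h (Suc n) m s v
      + of_real (v * (1 - v)) * ladder (C - s *\<^sub>R B) (\<lambda>m. h n m s v) m" for s v
  define K where "K v = integral {0..1} (\<lambda>s. Q s v)" for v

  have h_cont: "continuous_on S (\<lambda>x. h n m (f x) (g x))"
    if "continuous_on S f" "continuous_on S g" for n m f g and S :: "'b::topological_space set"
    unfolding h_def by (intro continuous_intros that)
  have Q_cont: "continuous_on S (\<lambda>x. Q (f x) (g x))"
    if "continuous_on S f" "continuous_on S g" for f g and S :: "'b::topological_space set"
    unfolding Q_def by (intro continuous_intros continuous_on_ladder h_cont that)

  have J: "((\<lambda>s. of_real (1 - v) * h n m s v) has_integral J n m v) {0..1}" for n m v
    unfolding J_def
    by (intro integrable_integral integrable_continuous_real continuous_intros h_cont)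
  have K: "((\<lambda>s. Q s v) has_integral K v) {0..1}" for v
    unfolding K_def
    by (intro integrable_integral integrable_continuous_real continuous_intros Q_cont)
  have J_cont: "continuous_on {0..1} (J n m)" for n m
    unfolding J_def box_real[symmetric]
    by (intro integral_continuous_on_param)
      (auto simp: case_prod_unfold intro!: continuous_intros h_cont)
  have K_cont: "continuous_on {0..1} K"
    unfolding K_def box_real[symmetric]
    by (intro integral_continuous_on_param)
      (auto simp: case_prod_unfold intro!: continuous_intros Q_cont)

  have "I n m = integral {0..1} (J n m)" for n m
    unfolding I_def
  proof (rule integral_cong)
    fix v :: real
    assume "v \<in> {0..1}"
    then have "integral {0..1 - v} (\<lambda>u. harmonic_R n m (A + u *\<^sub>R B + v *\<^sub>R C)) =
        integral {0..1} (\<lambda>s. (1 - v) *\<^sub>R harmonic_R n m (A + ((1 - v) * s) *\<^sub>R B + v *\<^sub>R C))"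
      by (intro integral_rescale_unit_interval continuous_intros) auto
    then show "integral {0..1 - v} (\<lambda>u. harmonic_R n m (A + u *\<^sub>R B + v *\<^sub>R C)) = J n m v"
      by (simp only: J_def h_def scaleR_conv_of_real)
  qed
  then have I: "(J n m has_integral I n m) {0..1}" for n m
    using integrable_integral[OF integrable_continuous_real[OF J_cont]] by simp

  have one: "((\<lambda>t. of_real t :: complex) has_vector_derivative 1) (at t)" for t
    using has_vector_derivative_of_real[OF DERIV_ident] by simp

  have P_int: "((\<lambda>s. P s v) has_integral h (Suc n) m 1 v) {0..1}" for v
  proof -
    have deriv: "((\<lambda>s. of_real s * h (Suc n) m s v) has_vector_derivative P s v) (at s)" for s
    proof -
      have "((\<lambda>s. A + ((1 - v) * s) *\<^sub>R B + v *\<^sub>R C) has_vector_derivative (1 - v) *\<^sub>R B) (at s)"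
        by (auto intro!: derivative_eq_intros)
      from has_vector_derivative_mult[OF one has_vector_derivative_harmonic_R[OF this, of n m]]
      show ?thesis by (simp add: h_def P_def add.commute)
    qed
    have "((\<lambda>s. P s v) has_integral
        of_real 1 * h (Suc n) m 1 v - of_real 0 * h (Suc n) m 0 v) {0..1}"
      by (rule fundamental_theorem_of_calculus[OF zero_le_one has_vector_derivative_at_within[OF deriv]])
    then show ?thesis by simp
  qed

  \<comment> \<open>The weight v (1 - v) vanishes at both ends. Exchanging the order of integration
    then makes the integral of \<open>K\<close> zero.\<close>
  have "integral {0..1} (\<lambda>v. Q s v) = 0" for s
  proof -
    have deriv: "((\<lambda>v. of_real (v * (1 - v)) * h (Suc n) m s v) has_vector_derivative Q s v) (at v)" for v
    proof -
      have "((\<lambda>v. A + ((1 - v) * s) *\<^sub>R B + v *\<^sub>R C) has_vector_derivative C - s *\<^sub>R B) (at v)"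
        by (auto intro!: derivative_eq_intros simp: algebra_simps)
      moreover have "((\<lambda>v. of_real (v * (1 - v)) :: complex) has_vector_derivative of_real (1 - 2 * v)) (at v)"
        by (intro has_vector_derivative_of_real)
          (auto intro!: derivative_eq_intros simp flip: has_real_derivative_iff_has_vector_derivative)
      ultimately show ?thesis
        using has_vector_derivative_mult[OF _ has_vector_derivative_harmonic_R]
        by (force simp: h_def Q_def add.commute)
    qed
    have "((\<lambda>v. Q s v) has_integral
        of_real (1 * (1 - 1)) * h (Suc n) m s 1 - of_real (0 * (1 - 0)) * h (Suc n) m s 0) {0..1}"
      by (rule fundamental_theorem_of_calculus[OF zero_le_one has_vector_derivative_at_within[OF deriv]])
    then show ?thesis by (simp add: has_integral_iff)
  qed
  moreover have "integral (cbox 0 1) (\<lambda>v. integral (cbox 0 1) (\<lambda>s. Q s v)) =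
      integral (cbox 0 1) (\<lambda>s. integral (cbox 0 1) (\<lambda>v. Q s v))"
    by (rule integral_swap_continuous)
      (auto simp: case_prod_unfold intro!: continuous_intros Q_cont)
  ultimately have "integral {0..1} K = 0"
    unfolding K_def by simp
  then have K_int: "(K has_integral 0) {0..1}"
    using integrable_integral[OF integrable_continuous_real[OF K_cont]] by simp

  \<comment> \<open>Of the n + 3 copies, n + 1 come from the recurrence in the degree. The other two
    are the divergence of (u, v): the undifferentiated terms of \<open>P\<close> and
    \<open>Q\<close> add up to 1 + (1 - 2v) = 2(1 - v).\<close>
  have split: "of_nat (n + 3) * (of_real (1 - v) * h (Suc n) m s v) =
      ladder A (\<lambda>m. of_real (1 - v) * h n m s v) m + P s v + Q s v" for s v
  proof -
    let ?L = "\<lambda>a. ladder a (\<lambda>m. h n m s v) m"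
    have euler: "of_nat (Suc n) * h (Suc n) m s v = ?L A + of_real ((1 - v) * s) * ?L B + of_real v * ?L C"
      unfolding h_def by (simp only: harmonic_R_Suc ladder_add ladder_scaleR)
    have diff: "?L (C - s *\<^sub>R B) = ?L C - of_real s * ?L B"
      using ladder_add[of C "(- s) *\<^sub>R B" "\<lambda>m. h n m s v" m]
      by (simp only: ladder_scaleR) simp
    have "of_nat (n + 3) * (of_real (1 - v) * h (Suc n) m s v) =
        of_real (1 - v) * (of_nat (Suc n) * h (Suc n) m s v) + 2 * of_real (1 - v) * h (Suc n) m s v"
      by (simp add: algebra_simps)
    then show ?thesis
      unfolding euler P_def Q_def ladder_mult ladder_scaleR diff by (simp add: algebra_simps)
  qed
  have "of_nat (n + 3) * J (Suc n) m v = ladder A (\<lambda>m. J n m v) m + h (Suc n) m 1 v + K v" for v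
  proof (rule has_integral_unique)
    show "((\<lambda>s. of_nat (n + 3) * (of_real (1 - v) * h (Suc n) m s v)) has_integral
        of_nat (n + 3) * J (Suc n) m v) {0..1}"
      by (intro has_integral_mult_right J)
    show "((\<lambda>s. of_nat (n + 3) * (of_real (1 - v) * h (Suc n) m s v)) has_integral
        ladder A (\<lambda>m. J n m v) m + h (Suc n) m 1 v + K v) {0..1}"
      unfolding split by (intro has_integral_add has_integral_ladder J P_int K)
  qed
  moreover have "((\<lambda>v. of_nat (n + 3) * J (Suc n) m v) has_integral of_nat (n + 3) * I (Suc n) m) {0..1}"
    by (intro has_integral_mult_right I)
  moreover have "((\<lambda>v. ladder A (\<lambda>m. J n m v) m + h (Suc n) m 1 v + K v) has_integral
      ladder A (I n) m + integral {0..1} (h (Suc n) m 1) + 0) {0..1}"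
    by (intro has_integral_add has_integral_ladder I K_int integrable_integral
        integrable_continuous_real h_cont continuous_intros)
  ultimately have "of_nat (n + 3) * I (Suc n) m = ladder A (I n) m + integral {0..1} (h (Suc n) m 1)"
    by (simp only: has_integral_iff add_0_right)
  \<comment> \<open>The side s = 1 is the edge u + v = 1, parametrised here by v; reflection passes
    to u.\<close>
  also have "integral {0..1} (h (Suc n) m 1) =
      integral {0..1} (\<lambda>u. harmonic_R (Suc n) m (A + u *\<^sub>R B + (1 - u) *\<^sub>R C))"
    by (subst integral_reflect_unit_interval[symmetric])
      (auto simp: h_def intro!: continuous_intros)
  finally show ?thesis .
qed

section \<open>The recurrences for the triangle and its edge\<close>

theorem lemma5:
  fixes Ru Rv Rw R0 :: "real ^ 3" and n :: nat and m :: int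
  assumes "1 \<le> n" and "- int n \<le> m" and "m \<le> int n"
  shows "coef_b Ru Rv Rw R0 n m =
           1 / (of_nat n + 2) *
             (\<i> * (xi R0 + xi Rw) * coef_b Ru Rv Rw R0 (n - 1) (m - 1)
              + \<i> * (eta R0 + eta Rw) * coef_b Ru Rv Rw R0 (n - 1) (m + 1)
              - of_real (R0 $ 3 + Rw $ 3) * coef_b Ru Rv Rw R0 (n - 1) m
              + coef_e Ru Rv Rw R0 n m)
       \<and> coef_e Ru Rv Rw R0 n m =
           1 / (of_nat n + 1) *
             (\<i> * (xi R0 + xi Rv) * coef_e Ru Rv Rw R0 (n - 1) (m - 1)
              + \<i> * (eta R0 + eta Rv) * coef_e Ru Rv Rw R0 (n - 1) (m + 1)
              - of_real (R0 $ 3 + Rv $ 3) * coef_e Ru Rv Rw R0 (n - 1) m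
              + coef_f Ru Rv Rw R0 n m)"
proof -
  obtain k where n: "n = Suc k"
    using assms(1) by (cases n) auto
  \<comment> \<open>The edge w = 0 is a segment based at \<open>R0 + Rv\<close>, with far end
    \<open>R0 + Ru\<close>, the point of \<open>coef_f\<close>.\<close>
  have e: "coef_e Ru Rv Rw R0 n m =
      integral {0..1} (\<lambda>t. harmonic_R n m ((R0 + Rv) + t *\<^sub>R (Ru - Rv)))" for n m
    unfolding coef_e_def coef_d_def coef_c_def
    by (intro integral_cong arg_cong[of _ _ "harmonic_R n m"]) (simp add: algebra_simps)
  \<comment> \<open>The same edge, seen as the side opposite the vertex \<open>R0 + Rw\<close> of
    the triangle.\<close>
  have e': "coef_e Ru Rv Rw R0 n m = integral {0..1} (\<lambda>u. harmonic_R n m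
      ((R0 + Rw) + u *\<^sub>R (Ru - Rw) + (1 - u) *\<^sub>R (Rv - Rw)))" for n m
    unfolding e
    by (intro integral_cong arg_cong[of _ _ "harmonic_R n m"]) (simp add: algebra_simps)
  have b: "coef_b Ru Rv Rw R0 n m = integral {0..1} (\<lambda>v. integral {0..1 - v} (\<lambda>u. harmonic_R n m
      ((R0 + Rw) + u *\<^sub>R (Ru - Rw) + v *\<^sub>R (Rv - Rw))))" for n m
    unfolding coef_b_def coef_d_def coef_c_def
    by (intro integral_cong arg_cong[of _ _ "harmonic_R n m"]) (simp add: algebra_simps)
  have f: "coef_f Ru Rv Rw R0 n m = harmonic_R n m ((R0 + Rv) + (Ru - Rv))"
    by (simp add: coef_f_def coef_c_def add.commute)
  have bn: "of_nat n + 2 = (of_nat (k + 3) :: complex)" "of_nat n + 1 = (of_nat (k + 2) :: complex)"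
    by (simp_all add: n)
  have nz: "of_nat (k + 3) \<noteq> (0 :: complex)" "of_nat (k + 2) \<noteq> (0 :: complex)"
    unfolding of_nat_eq_0_iff by simp_all
  have "of_nat (k + 3) * coef_b Ru Rv Rw R0 n m =
      ladder (R0 + Rw) (coef_b Ru Rv Rw R0 k) m + coef_e Ru Rv Rw R0 n m"
    using triangle_recurrence[of k m "R0 + Rw" "Ru - Rw" "Rv - Rw"]
    unfolding n b[abs_def] e' .
  moreover have "of_nat (k + 2) * coef_e Ru Rv Rw R0 n m =
      ladder (R0 + Rv) (coef_e Ru Rv Rw R0 k) m + coef_f Ru Rv Rw R0 n m"
    using segment_recurrence[of k m "R0 + Rv" "Ru - Rv"]
    unfolding f unfolding n e[abs_def] .
  moreover have "xi (a + b) = xi a + xi b" "eta (a + b) = eta a + eta b" for a b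
    by (simp_all add: xi_def eta_def algebra_simps add_divide_distrib diff_divide_distrib)
  ultimately show ?thesis
    unfolding bn using nz by (simp add: ladder_def n eq_divide_eq mult.commute del: of_nat_add)
qed

end
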